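(* Let $k\ge 3$ and let $G$ be a mixed $k$-melon graph whose set of paths $\mathcal{P}=\mathcal{P}_{even}\cup\mathcal{P}_{odd}$ satisfies $|\mathcal{P}_{odd}|=1$, say $\mathcal{P}_{odd}=\{P_o\}$. For $x\in\{s,t\}$ and $P_e\in\mathcal{P}_{even}$ let $U^{x}_{P_e}$ be the vertex set such that $P_e$ is external, every path of $\mathcal{P}_{even}\setminus\{P_e\}$ is internal, and $P_o$ is an $x$-path, all with respect to $U^{x}_{P_e}$. Then $\mathrm{evc}(G)=\mathrm{vc}(G)+1$, and $\mathcal{U}=\{U^{x}_{P_e} : x\in\{s,t\},\ P_e\in\mathcal{P}_{even}\}$ is a minimum eternal vertex cover class of $G$.
   Context: For $k\ge1$, a $k$-melon graph is the union of a set $\mathcal{P}$ of $k$ pairwise internally vertex-disjoint paths, each of length at least $1$, with the same two distinct endpoints $s$ and $t$. $\mathcal{P}_{even}$ and $\mathcal{P}_{odd}$ are the paths of even and odd length; $G$ is mixed if both are nonempty. For an even path $P$ with vertices $v_0,\dots,v_{2m}$, $\{v_0,v_{2m}\}=\{s,t\}$, and a vertex set $U$: $P$ is internal w.r.t. $U$ if $U\cap V(P)=\{v_{2j}:0\le j\le m\}$, external if $U\cap V(P)=\{v_{2j+1}:0\le j\le m-1\}\cup\{s,t\}$. For an odd path $P_o$ with vertices $v_0=t,\dots,v_{2m+1}=s$: $P_o$ is an $s$-path w.r.t. $U$ if $(U\cap V(P_o))\setminus\{t\}=\{v_{2i+1}:0\le i\le m\}$, a $t$-path if $(U\cap V(P_o))\setminus\{s\}=\{v_{2i}:0\le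 i\le m\}$. $\mathrm{vc}(G)$ is the vertex cover number. For a vertex cover $U$ of $G=(V,E)$ and an edge $e=vw$, a defense of $U$ against $e$ is a one-to-one map $\phi:U\to V$ with $\phi(u)\in N[u]$ (closed neighborhood) for all $u\in U$ and $\phi(v)=w$ (with $v\in U$) or $\phi(w)=v$ (with $w\in U$). An eternal vertex cover class is a family $\mathcal{U}$ of vertex covers of equal cardinality (its size) such that for every $U\in\mathcal{U}$ and every edge $e$ there is a defense $\phi$ of $U$ against $e$ with $\phi(U)\in\mathcal{U}$; $\mathrm{evc}(G)$ is the minimum size of such a class, and a class of that size is minimum. *)

theory Defs
  imports "Graph_Theory.Graph_Theory"
begin

text \<open>
  Finite simple undirected graphs are the symmetric loop-free digraphs of the locale
  \<^locale>\<open>pair_graph\<close>: an edge \<open>vw\<close> is the pair of arcs \<open>(v, w)\<close>, \<open>(w, v)\<close>.  The covering and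
  defense conditions below are symmetric in \<open>v\<close> and \<open>w\<close>, so quantifying over arcs is
  quantifying over edges.
\<close>

definition closed_nbhd :: "'a pair_pre_digraph \<Rightarrow> 'a \<Rightarrow> 'a set" where
  "closed_nbhd G u = insert u {w. (u, w) \<in> parcs G}"

definition vertex_cover :: "'a pair_pre_digraph \<Rightarrow> 'a set \<Rightarrow> bool" where
  "vertex_cover G U \<longleftrightarrow> U \<subseteq> pverts G \<and> (\<forall>(v, w) \<in> parcs G. v \<in> U \<or> w \<in> U)"

definition vc :: "'a pair_pre_digraph \<Rightarrow> nat" where
  "vc G = (LEAST n. \<exists>U. vertex_cover G U \<and> card U = n)"

definition is_defense ::
    "'a pair_pre_digraph \<Rightarrow> 'a set \<Rightarrow> 'a \<times> 'a \<Rightarrow> ('a \<Rightarrow> 'a) \<Rightarrow> bool" where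
  "is_defense G U e \<phi> \<longleftrightarrow>
     \<phi> \<in> U \<rightarrow> pverts G \<and> inj_on \<phi> U \<and> (\<forall>u \<in> U. \<phi> u \<in> closed_nbhd G u) \<and>
     (case e of (v, w) \<Rightarrow> (v \<in> U \<and> \<phi> v = w) \<or> (w \<in> U \<and> \<phi> w = v))"

text \<open>A class is nonempty; otherwise it would have no well-defined size.\<close>

definition eternal_vc_class :: "'a pair_pre_digraph \<Rightarrow> nat \<Rightarrow> 'a set set \<Rightarrow> bool" where
  "eternal_vc_class G n \<U> \<longleftrightarrow>
     \<U> \<noteq> {} \<and> (\<forall>U \<in> \<U>. vertex_cover G U \<and> card U = n) \<and>
     (\<forall>U \<in> \<U>. \<forall>e \<in> parcs G. \<exists>\<phi>. is_defense G U e \<phi> \<and> \<phi> ` U \<in> \<U>)"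

definition evc :: "'a pair_pre_digraph \<Rightarrow> nat" where
  "evc G = (LEAST n. \<exists>\<U>. eternal_vc_class G n \<U>)"

definition minimum_eternal_vc_class :: "'a pair_pre_digraph \<Rightarrow> 'a set set \<Rightarrow> bool" where
  "minimum_eternal_vc_class G \<U> \<longleftrightarrow> eternal_vc_class G (evc G) \<U>"

text \<open>
  A path with endpoints \<open>s\<close> and \<open>t\<close> is represented by the list of its vertices in the order
  from \<open>s\<close> to \<open>t\<close>.  As \<open>s \<noteq> t\<close>, this makes lists and paths (as subgraphs) correspond
  one-to-one, so \<^term>\<open>card Ps\<close> counts the paths.
\<close>

definition melon_graph ::
    "nat \<Rightarrow> 'a pair_pre_digraph \<Rightarrow> 'a \<Rightarrow> 'a \<Rightarrow> 'a vwalk set \<Rightarrow> bool" where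
  "melon_graph k G s t Ps \<longleftrightarrow>
     1 \<le> k \<and> finite Ps \<and> card Ps = k \<and> s \<noteq> t \<and>
     (\<forall>p \<in> Ps. vpath p (with_proj G) \<and> 1 \<le> vwalk_length p \<and> hd p = s \<and> last p = t) \<and>
     (\<forall>p \<in> Ps. \<forall>q \<in> Ps. p \<noteq> q \<longrightarrow> set p \<inter> set q \<subseteq> {s, t}) \<and>
     pverts G = (\<Union>p \<in> Ps. set p) \<and>
     parcs G = (\<Union>p \<in> Ps. set (vwalk_arcs p) \<union> (set (vwalk_arcs p))\<inverse>)"

lemma vwalk_arcs_distinct_ends:
  assumes "distinct p" and "e \<in> set (vwalk_arcs p)"
  shows "fst e \<in> set p" and "snd e \<in> set p" and "fst e \<noteq> snd e"
  using assms by (induction p rule: vwalk_arcs.induct) auto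

lemma melon_graph_imp_pair_graph:
  assumes "melon_graph k G s t Ps"
  shows "pair_graph G"
proof -
  have V: "pverts G = (\<Union>p \<in> Ps. set p)"
    and E: "parcs G = (\<Union>p \<in> Ps. set (vwalk_arcs p) \<union> (set (vwalk_arcs p))\<inverse>)"
    and fin: "finite Ps" and d: "\<And>p. p \<in> Ps \<Longrightarrow> distinct p"
    using assms by (auto simp: melon_graph_def vpath_def)
  have ends: "fst e \<in> pverts G \<and> snd e \<in> pverts G \<and> fst e \<noteq> snd e" if e: "e \<in> parcs G" for e
  proof -
    obtain p where p: "p \<in> Ps" "e \<in> set (vwalk_arcs p) \<or> (snd e, fst e) \<in> set (vwalk_arcs p)"
      using e E by (cases e) auto
    then have "fst e \<in> set p" "snd e \<in> set p" "fst e \<noteq> snd e"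
      using vwalk_arcs_distinct_ends[OF d[OF p(1)], of e]
        vwalk_arcs_distinct_ends[OF d[OF p(1)], of "(snd e, fst e)"] by auto
    with p(1) V show ?thesis
      by blast
  qed
  have "sym (parcs G)"
    unfolding E by (rule symI) auto
  moreover have "finite (pverts G)" "finite (parcs G)"
    unfolding V E using fin by auto
  ultimately show ?thesis
    using ends by unfold_locales (simp_all add: symmetric_def)
qed

definition even_paths :: "'a vwalk set \<Rightarrow> 'a vwalk set" where
  "even_paths Ps = {p \<in> Ps. even (vwalk_length p)}"

definition odd_paths :: "'a vwalk set \<Rightarrow> 'a vwalk set" where
  "odd_paths Ps = {p \<in> Ps. odd (vwalk_length p)}"

definition mixed :: "'a vwalk set \<Rightarrow> bool" where
  "mixed Ps \<longleftrightarrow> even_paths Ps \<noteq> {} \<and> odd_paths Ps \<noteq> {}"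

text \<open>
  Below, \<open>m\<close> is \<^term>\<open>vwalk_length p div 2\<close>: even paths have length \<open>2m\<close> and odd ones \<open>2m + 1\<close>.
\<close>

definition internal_path :: "'a set \<Rightarrow> 'a vwalk \<Rightarrow> bool" where
  "internal_path U p \<longleftrightarrow> U \<inter> set p = {p ! (2 * j) | j. j \<le> vwalk_length p div 2}"

definition external_path :: "'a \<Rightarrow> 'a \<Rightarrow> 'a set \<Rightarrow> 'a vwalk \<Rightarrow> bool" where
  "external_path s t U p \<longleftrightarrow>
     U \<inter> set p = {p ! (2 * j + 1) | j. j < vwalk_length p div 2} \<union> {s, t}"

text \<open>
  Odd paths are enumerated as \<open>v\<^sub>0 = t, \<dots>, v\<^sub>2\<^sub>m\<^sub>+\<^sub>1 = s\<close>, that is, against the orientation of the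
  list representing them.
\<close>

definition s_path :: "'a \<Rightarrow> 'a set \<Rightarrow> 'a vwalk \<Rightarrow> bool" where
  "s_path t U p \<longleftrightarrow> (U \<inter> set p) - {t} = {rev p ! (2 * i + 1) | i. i \<le> vwalk_length p div 2}"

definition t_path :: "'a \<Rightarrow> 'a set \<Rightarrow> 'a vwalk \<Rightarrow> bool" where
  "t_path s U p \<longleftrightarrow> (U \<inter> set p) - {s} = {rev p ! (2 * i) | i. i \<le> vwalk_length p div 2}"

definition melon_cover ::
    "'a pair_pre_digraph \<Rightarrow> 'a \<Rightarrow> 'a \<Rightarrow> 'a vwalk set \<Rightarrow> 'a vwalk \<Rightarrow> 'a \<Rightarrow> 'a vwalk \<Rightarrow> 'a set" where
  "melon_cover G s t Ps Po x Pe =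
     (THE U. U \<subseteq> pverts G \<and> external_path s t U Pe \<and>
        (\<forall>p \<in> even_paths Ps - {Pe}. internal_path U p) \<and>
        (if x = s then s_path t U Po else t_path s U Po))"

end

theory Submission
  imports Defs
begin

text \<open>
  A vertex set containing \<open>s\<close>, \<open>t\<close> and, on every path, the interior vertices of one fixed parity
  is a vertex cover; the sets \<open>U\<^sup>x\<^sub>P\<close> are of this kind.  Choosing on every even path the parity of
  the endpoints gives a cover whose size is seen to be minimum by a matching on every path.  A
  cover of this size cannot contain a neighbour of \<open>s\<close> on an even path, as this would cost one
  more vertex there, nor can it miss \<open>s\<close> or \<open>t\<close>, as this would cost one more vertex on each of
  the (at least two) even paths.  Hence an attack on the first edge of an even path cannot be
  answered by minimum covers.

  Conversely, let \<open>e\<close> be the external path and \<open>p\<close> another even path.  Shifting the guards of \<open>e\<close>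
  towards an endpoint and those of \<open>p\<close> away from it, through that endpoint, makes \<open>p\<close> the external
  path, and answers attacks on \<open>e\<close> and \<open>p\<close>.  Half of the edges of the odd path are answered by
  shifting its interior guards only, the other half by a rotation of the guards on the odd path,
  \<open>e\<close> and \<open>p\<close> along the cycles through \<open>s\<close> and \<open>t\<close>.
\<close>

section \<open>Counting by parity on index intervals\<close>

text \<open>The \<open>m\<close> pairs \<open>f (r + 2 * j)\<close>,
  \<open>f (r + 2 * j + 1)\<close> are disjoint by injectivity and each meets \<open>W\<close>. On a
  path they become the edges of a matching.\<close>

lemma card_hit_matching:
  assumes "inj_on f {r..<r + 2 * m}"
    and "\<And>j. j < m \<Longrightarrow> f (r + 2 * j) \<in> W \<or> f (r + 2 * j + 1) \<in> W"
  shows "m \<le> card (W \<inter> f ` {r..<r + 2 * m})"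
  using assms
proof (induction m)
  case 0
  then show ?case by simp
next
  case (Suc m)
  let ?A = "W \<inter> f ` {r..<r + 2 * m}" and ?B = "W \<inter> {f (r + 2 * m), f (r + 2 * m + 1)}"
  have inj: "inj_on f {r..<r + 2 * m}"
    using Suc.prems(1) by (rule inj_on_subset) auto
  have "{r..<r + 2 * Suc m} = {r..<r + 2 * m} \<union> {r + 2 * m, r + 2 * m + 1}"
    by auto
  then have split: "W \<inter> f ` {r..<r + 2 * Suc m} = ?A \<union> ?B"
    by auto
  have disj: "?A \<inter> ?B = {}"
    using Suc.prems(1) by (auto dest!: inj_onD)
  have "?B \<noteq> {}"
    using Suc.prems(2)[of m] by auto
  then have "1 \<le> card ?B"
    by (simp add: Suc_le_eq card_gt_0_iff)
  moreover have "m \<le> card ?A"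
    using Suc.IH[OF inj] Suc.prems(2) by simp
  ultimately show ?case
    unfolding split using disj by (subst card_Un_disjoint) auto
qed

text \<open>For even positive \<open>l\<close> there is one more odd index than even ones, for odd
  \<open>l\<close> there are equally many. This is why an external even path costs one extra guard,
  while the odd path changes parity for free.\<close>

lemma card_interior_parity:
  "card {i. 0 < i \<and> i < l \<and> (even i \<longleftrightarrow> b)} = (if b then (l - 1) div 2 else l div 2)"
proof -
  have "{i. 0 < i \<and> i < l \<and> (even i \<longleftrightarrow> b)} =
      (if b then (\<lambda>j. 2 * j + 2) ` {..<(l - 1) div 2} else (\<lambda>j. 2 * j + 1) ` {..<l div 2})"
  proof (intro equalityI subsetI)
    fix i assume i: "i \<in> {i. 0 < i \<and> i < l \<and> (even i \<longleftrightarrow> b)}"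
    show "i \<in> (if b then (\<lambda>j. 2 * j + 2) ` {..<(l - 1) div 2} else (\<lambda>j. 2 * j + 1) ` {..<l div 2})"
    proof (cases b)
      case True
      then have "i = 2 * ((i - 2) div 2) + 2" "(i - 2) div 2 < (l - 1) div 2"
        using i by (auto elim!: evenE)
      then show ?thesis using True by auto
    next
      case False
      then have "i = 2 * (i div 2) + 1" "i div 2 < l div 2"
        using i by (auto elim!: oddE)
      then show ?thesis using False by auto
    qed
  next
    fix i assume "i \<in> (if b then (\<lambda>j. 2 * j + 2) ` {..<(l - 1) div 2} else (\<lambda>j. 2 * j + 1) ` {..<l div 2})"
    then show "i \<in> {i. 0 < i \<and> i < l \<and> (even i \<longleftrightarrow> b)}"
      by (auto split: if_splits)
  qed
  moreover have "inj_on (\<lambda>j::nat. 2 * j + 2) A" "inj_on (\<lambda>j::nat. 2 * j + 1) A" for A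
    by (auto simp: inj_on_def)
  ultimately show ?thesis
    by (simp add: card_image)
qed

text \<open>Consecutive numbers differ in parity, so \<open>Suc i\<close> cannot be
  \<open>n\<close>. With \<open>n = l p\<close> this keeps shifted positions in the
  interior.\<close>

lemma Suc_less_same_parity:
  assumes "i < n" "even i \<longleftrightarrow> even n"
  shows "Suc i < n"
  using assms by (metis Suc_lessI even_Suc)

lemma set_vwalk_arcs: "set (vwalk_arcs p) = {(p ! i, p ! Suc i) | i. i < vwalk_length p}"
proof (induction p rule: vwalk_arcs.induct)
  case (3 x y xs)
  have "{(p ! i, p ! Suc i) | i. i < Suc n} = insert (p ! 0, p ! 1) {(p ! Suc i, p ! Suc (Suc i)) | i. i < n}"
    for p :: "'a list" and n
    by (auto simp: less_Suc_eq_0_disj)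
  from this[of "x # y # xs" "length xs"] 3 show ?case
    by (simp add: vwalk_length_def)
qed (auto simp: vwalk_length_def)

text \<open>
  The vertices of the path \<open>p\<close> are \<open>v p 0 = s, \<dots>, v p (l p) = t\<close>, and \<open>po\<close> is the odd path.
  Reversing all paths gives another instance of the locale with \<open>s\<close> and \<open>t\<close> exchanged.
\<close>

locale one_odd_melon =
  fixes G :: "'a pair_pre_digraph" and P :: "'i set" and po :: 'i
    and v :: "'i \<Rightarrow> nat \<Rightarrow> 'a" and l :: "'i \<Rightarrow> nat" and s t :: 'a
  assumes finite_P: "finite P" and card_P: "3 \<le> card P"
    and po: "po \<in> P" "odd (l po)"
    and even_l: "\<And>p. p \<in> P \<Longrightarrow> p \<noteq> po \<Longrightarrow> even (l p)"
    and l_pos: "\<And>p. p \<in> P \<Longrightarrow> 0 < l p"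
    and v_0: "\<And>p. p \<in> P \<Longrightarrow> v p 0 = s"
    and v_l: "\<And>p. p \<in> P \<Longrightarrow> v p (l p) = t"
    and v_inj: "\<And>p i j. p \<in> P \<Longrightarrow> i \<le> l p \<Longrightarrow> j \<le> l p \<Longrightarrow> v p i = v p j \<Longrightarrow> i = j"
    and v_disjoint: "\<And>p q i j. p \<in> P \<Longrightarrow> q \<in> P \<Longrightarrow> p \<noteq> q \<Longrightarrow> i \<le> l p \<Longrightarrow> j \<le> l q \<Longrightarrow>
      v p i = v q j \<Longrightarrow> v p i \<in> {s, t}"
    and pverts_G: "pverts G = (\<Union>p \<in> P. v p ` {..l p})"
    and parcs_G: "parcs G = {(v p i, v p (Suc i)) | p i. p \<in> P \<and> i < l p} \<union>
      {(v p (Suc i), v p i) | p i. p \<in> P \<and> i < l p}"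
begin

section \<open>Coordinates of vertices and reversal of the paths\<close>

lemma s_neq_t: "s \<noteq> t"
  using v_inj[OF po(1), of 0 "l po"] v_0[OF po(1)] v_l[OF po(1)] l_pos[OF po(1)] by auto

lemma interior_neq:
  assumes "p \<in> P" "0 < i" "i < l p"
  shows "v p i \<noteq> s" "v p i \<noteq> t"
  using v_inj[OF assms(1), of i 0] v_inj[OF assms(1), of i "l p"] assms v_0 v_l by auto

text \<open>Only \<open>s\<close> and \<open>t\<close> are shared between paths, so an interior
  vertex determines its path and its index. This justifies prescribing covers and guard moves by
  coordinates.\<close>

lemma interior_unique:
  assumes "p \<in> P" "0 < i" "i < l p" "q \<in> P" "j \<le> l q" "v p i = v q j"
  shows "p = q" "i = j"
proof -
  show "p = q"
    using v_disjoint[of p q i j] interior_neq[of p i] assms by auto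
  then show "i = j"
    using v_inj[of p i j] assms by auto
qed

lemma even_l_ge_2: "p \<in> P \<Longrightarrow> p \<noteq> po \<Longrightarrow> 2 \<le> l p"
  using even_l[of p] l_pos[of p] by (auto elim!: evenE)

lemma one_odd_melon_reverse: "one_odd_melon G P po (\<lambda>p i. v p (l p - i)) l t s"
proof
  \<comment> \<open>Reversal gives the edge with index \<open>i\<close> the new index
    \<open>l p - Suc i\<close> and flips its direction, so the two families of arcs in
    \<open>parcs_G\<close> change places.\<close>
  have arcs: "{(v p (Suc i), v p i) | p i. p \<in> P \<and> i < l p} =
      {(v p (l p - i), v p (l p - Suc i)) | p i. p \<in> P \<and> i < l p}" (is "?A = ?B")
    "{(v p i, v p (Suc i)) | p i. p \<in> P \<and> i < l p} =
      {(v p (l p - Suc i), v p (l p - i)) | p i. p \<in> P \<and> i < l p}" (is "?C = ?D")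
  proof -
    have flip: "l p - (l p - Suc i) = Suc i" "l p - Suc (l p - Suc i) = i" "l p - Suc i < l p"
      if "i < l p" for p i
      using that by auto
    have suc: "l p - i = Suc (l p - Suc i)" if "i < l p" for p i
      using that by auto
    have "\<exists>j<l p. v p (Suc i) = v p (l p - j) \<and> v p i = v p (l p - Suc j)" if "i < l p" for p i
      using that flip[OF that] by metis
    then show "?A = ?B" "?C = ?D"
      using suc flip(3) by fastforce+
  qed
  show "parcs G = {(v p (l p - i), v p (l p - Suc i)) |p i. p \<in> P \<and> i < l p} \<union>
      {(v p (l p - Suc i), v p (l p - i)) |p i. p \<in> P \<and> i < l p}"
    unfolding parcs_G arcs by blast
  have "(\<lambda>i. v p (l p - i)) ` {..l p} = v p ` {..l p}" for p
  proof -
    have "x \<in> (\<lambda>i. l p - i) ` {..l p}" if "x \<le> l p" for x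
      using that by (intro image_eqI[of _ _ "l p - x"]) auto
    then have "(\<lambda>i. l p - i) ` {..l p} = {..l p}"
      by auto
    then show ?thesis
      by (metis image_image)
  qed
  then show "pverts G = (\<Union>p \<in> P. (\<lambda>i. v p (l p - i)) ` {..l p})"
    using pverts_G by simp
  show "i = j" if "p \<in> P" "i \<le> l p" "j \<le> l p" "v p (l p - i) = v p (l p - j)" for p i j
    using v_inj[of p "l p - i" "l p - j"] that by auto
  show "v p (l p - i) \<in> {t, s}"
    if "p \<in> P" "q \<in> P" "p \<noteq> q" "i \<le> l p" "j \<le> l q" "v p (l p - i) = v q (l q - j)" for p q i j
    using v_disjoint[of p q "l p - i" "l q - j"] that by auto
qed (use finite_P card_P po even_l l_pos v_0 v_l in auto)

subsection \<open>Covers of prescribed parity\<close>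

text \<open>On an even path \<open>c p\<close> chooses between internal (\<open>True\<close>) and
  external (\<open>False\<close>), on \<open>po\<close> between an \<open>s\<close>-path
  (\<open>True\<close>) and a \<open>t\<close>-path (\<open>False\<close>), since indices are
  counted from \<open>s\<close>.\<close>

definition parity_cover :: "('i \<Rightarrow> bool) \<Rightarrow> 'a set" where
  "parity_cover c = {s, t} \<union> {v p i | p i. p \<in> P \<and> 0 < i \<and> i < l p \<and> (even i \<longleftrightarrow> c p)}"

lemma v_in_parity_cover:
  assumes "p \<in> P" "i \<le> l p"
  shows "v p i \<in> parity_cover c \<longleftrightarrow> i = 0 \<or> i = l p \<or> (even i \<longleftrightarrow> c p)"
proof (cases "i = 0 \<or> i = l p")
  case True
  then show ?thesis using assms v_0 v_l by (auto simp: parity_cover_def)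
next
  case False
  then have i: "0 < i" "i < l p" using assms by auto
  have "even i \<longleftrightarrow> c p" if "v p i \<in> parity_cover c"
  proof -
    obtain q j where "q \<in> P" "j < l q" "even j \<longleftrightarrow> c q" "v p i = v q j"
      using \<open>v p i \<in> parity_cover c\<close> interior_neq[OF assms(1) i] by (auto simp: parity_cover_def)
    then show ?thesis
      using interior_unique[OF assms(1) i, of q j] by simp
  qed
  moreover have "v p i \<in> parity_cover c" if "even i \<longleftrightarrow> c p"
    using that i assms(1) by (auto simp: parity_cover_def)
  ultimately show ?thesis
    using i by auto
qed

lemma st_in_pverts: "s \<in> pverts G" "t \<in> pverts G"
  using pverts_G po(1) v_0[OF po(1)] v_l[OF po(1)] by force+

lemma parity_cover_subset: "parity_cover c \<subseteq> pverts G"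
  using st_in_pverts by (auto simp: parity_cover_def pverts_G)

lemma vertex_cover_parity_cover: "vertex_cover G (parity_cover c)"
proof -
  have "v p i \<in> parity_cover c \<or> v p (Suc i) \<in> parity_cover c" if "p \<in> P" "i < l p" for p i
    using that by (auto simp: v_in_parity_cover)
  then show ?thesis
    unfolding vertex_cover_def using parity_cover_subset by (auto simp: parcs_G)
qed

lemma finite_pverts: "finite (pverts G)"
  using finite_P by (simp add: pverts_G)

lemma pverts_eq: "pverts G = {s, t} \<union> (\<Union>p \<in> P. v p ` {0<..<l p})"
proof -
  have "v p ` {..l p} = {s, t} \<union> v p ` {0<..<l p}" if "p \<in> P" for p
  proof -
    have "{..l p} = {0, l p} \<union> {0<..<l p}"
      by auto
    then show ?thesis
      using v_0[OF that] v_l[OF that] by auto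
  qed
  then show ?thesis
    unfolding pverts_G using po(1) by auto
qed

text \<open>The set \<open>{s, t}\<close> and the interiors of the paths partition the vertices, so
  sizes can be compared path by path.\<close>

lemma card_decompose:
  assumes "W \<subseteq> pverts G"
  shows "card W = card (W \<inter> {s, t}) + (\<Sum>p \<in> P. card (W \<inter> v p ` {0<..<l p}))"
proof -
  let ?I = "\<lambda>p. W \<inter> v p ` {0<..<l p}"
  have W: "W = (W \<inter> {s, t}) \<union> (\<Union>p \<in> P. ?I p)"
    using assms unfolding pverts_eq by blast
  have "(W \<inter> {s, t}) \<inter> (\<Union>p \<in> P. ?I p) = {}"
  proof (rule equals0I)
    fix x assume x: "x \<in> (W \<inter> {s, t}) \<inter> (\<Union>p \<in> P. ?I p)"
    then obtain p i where "p \<in> P" "0 < i" "i < l p" "x = v p i"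
      by auto
    then show False
      using interior_neq[of p i] x by simp
  qed
  then have "card ((W \<inter> {s, t}) \<union> (\<Union>p \<in> P. ?I p)) = card (W \<inter> {s, t}) + card (\<Union>p \<in> P. ?I p)"
    using finite_P by (intro card_Un_disjoint) auto
  then have "card W = card (W \<inter> {s, t}) + card (\<Union>p \<in> P. ?I p)"
    unfolding W[symmetric] .
  also have "card (\<Union>p \<in> P. ?I p) = (\<Sum>p \<in> P. card (?I p))"
  proof (rule card_UN_disjoint)
    show "\<forall>p\<in>P. \<forall>q\<in>P. p \<noteq> q \<longrightarrow> ?I p \<inter> ?I q = {}"
    proof (intro ballI impI equals0I)
      fix p q x assume "p \<in> P" "q \<in> P" "p \<noteq> q" "x \<in> ?I p \<inter> ?I q"
      moreover from this obtain i j where "0 < i" "i < l p" "j < l q" "v p i = v q j"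
        by auto
      ultimately show False
        using interior_unique(1)[of p i q j] by simp
    qed
  qed (use finite_P in auto)
  finally show ?thesis .
qed

text \<open>The summand is the size of a maximum matching on the interior of \<open>p\<close>, and 2
  accounts for \<open>s\<close> and \<open>t\<close>. The total turns out to be \<open>vc G\<close>
  in \<open>vc_eq\<close>.\<close>

definition min_cover_size :: nat where
  "min_cover_size = 2 + (\<Sum>p \<in> P. (l p - 1) div 2)"

lemma card_parity_cover:
  "card (parity_cover c) = min_cover_size + card {p \<in> P. p \<noteq> po \<and> \<not> c p}"
proof -
  have int: "card (parity_cover c \<inter> v p ` {0<..<l p}) =
      (l p - 1) div 2 + (if p \<noteq> po \<and> \<not> c p then 1 else 0)" if p: "p \<in> P" for p
  proof -
    have "parity_cover c \<inter> v p ` {0<..<l p} = v p ` {i. 0 < i \<and> i < l p \<and> (even i \<longleftrightarrow> c p)}"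
      using v_in_parity_cover[OF p] by auto
    moreover have "inj_on (v p) {i. 0 < i \<and> i < l p \<and> (even i \<longleftrightarrow> c p)}"
      using v_inj[OF p] by (auto intro!: inj_onI)
    ultimately have "card (parity_cover c \<inter> v p ` {0<..<l p}) =
        (if c p then (l p - 1) div 2 else l p div 2)"
      by (simp add: card_image card_interior_parity)
    \<comment> \<open>Choosing odd instead of even indices costs one vertex exactly when
      \<open>l p\<close> is even, that is, off \<open>po\<close>.\<close>
    moreover have "l p div 2 = (l p - 1) div 2 + (if p = po then 0 else 1)"
      using po even_l[OF p] l_pos[OF p] by (auto elim!: oddE evenE)
    ultimately show ?thesis
      by auto
  qed
  have "parity_cover c \<inter> {s, t} = {s, t}"
    by (auto simp: parity_cover_def)
  then have "card (parity_cover c) = 2 + (\<Sum>p \<in> P. (l p - 1) div 2 + (if p \<noteq> po \<and> \<not> c p then 1 else 0))"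
    using card_decompose[OF parity_cover_subset, of c] int s_neq_t by simp
  then show ?thesis
    using finite_P by (simp add: sum.distrib min_cover_size_def sum.If_cases Int_def)
qed

subsection \<open>Lower bounds on vertex covers\<close>

lemma vertex_coverD:
  assumes "vertex_cover G W" "p \<in> P" "i < l p"
  shows "v p i \<in> W \<or> v p (Suc i) \<in> W"
  using assms unfolding vertex_cover_def parcs_G by blast

lemma path_inj_on: "p \<in> P \<Longrightarrow> A \<subseteq> {..l p} \<Longrightarrow> inj_on (v p) A"
  using v_inj by (intro inj_onI) (meson atMost_iff subsetD)

text \<open>The segment ends at index \<open>r + 2 * m - 1\<close>, which may be \<open>l p\<close>;
  with \<open>r = 0\<close> it starts at \<open>s\<close>. Thus the matching may use the endpoints
  of the path.\<close>

lemma card_vertex_cover_segment: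
  assumes "vertex_cover G W" "p \<in> P" "r + 2 * m \<le> Suc (l p)"
  shows "m \<le> card (W \<inter> v p ` {r..<r + 2 * m})"
proof (rule card_hit_matching)
  show "inj_on (v p) {r..<r + 2 * m}"
    using assms by (intro path_inj_on) auto
  show "v p (r + 2 * j) \<in> W \<or> v p (r + 2 * j + 1) \<in> W" if "j < m" for j
    using vertex_coverD[OF assms(1,2), of "r + 2 * j"] that assms(3) by simp
qed

lemma card_interior_ge:
  assumes W: "vertex_cover G W" and p: "p \<in> P"
  shows "(l p - 1) div 2 \<le> card (W \<inter> v p ` {0<..<l p})"
proof -
  have "(l p - 1) div 2 \<le> card (W \<inter> v p ` {1..<1 + 2 * ((l p - 1) div 2)})"
    using l_pos[OF p] by (intro card_vertex_cover_segment[OF W p]) linarith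
  also have "\<dots> \<le> card (W \<inter> v p ` {0<..<l p})"
    by (intro card_mono) auto
  finally show ?thesis .
qed

text \<open>Let \<open>l p = 2 * m\<close>. If \<open>s\<close> or \<open>t\<close> is missing from
  \<open>W\<close>, a matching of \<open>m\<close> edges through that endpoint has all its hits in
  the interior. If \<open>v p 1\<close> is in \<open>W\<close>, it adds one to the
  \<open>m - 1\<close> hits on the matching that starts at index 2.\<close>

lemma card_interior_gt:
  assumes W: "vertex_cover G W" and p: "p \<in> P" "p \<noteq> po"
    and "s \<notin> W \<or> t \<notin> W \<or> v p 1 \<in> W"
  shows "(l p - 1) div 2 < card (W \<inter> v p ` {0<..<l p})"
proof -
  obtain m where m: "l p = 2 * m" "0 < m"
    using even_l[OF p] l_pos[OF p(1)] by (auto elim!: evenE)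
  have sub: "m \<le> card (W \<inter> v p ` {0<..<l p})"
    if "m \<le> card X" "X \<subseteq> W \<inter> v p ` {0<..<l p}" for X
    using that card_mono[OF _ that(2)] by fastforce
  consider "s \<notin> W" | "t \<notin> W" | "v p 1 \<in> W" using assms(4) by blast
  then have "m \<le> card (W \<inter> v p ` {0<..<l p})"
  proof cases
    case 1
    have "m \<le> card (W \<inter> v p ` {0..<0 + 2 * m})"
      using card_vertex_cover_segment[OF W p(1), of 0 m] m by simp
    then show ?thesis
    proof (rule sub)
      show "W \<inter> v p ` {0..<0 + 2 * m} \<subseteq> W \<inter> v p ` {0<..<l p}"
      proof
        fix x assume "x \<in> W \<inter> v p ` {0..<0 + 2 * m}"
        then obtain i where "x = v p i" "i < l p" "x \<in> W" using m by auto
        moreover from this have "i \<noteq> 0" using 1 v_0[OF p(1)] by metis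
        ultimately show "x \<in> W \<inter> v p ` {0<..<l p}" by auto
      qed
    qed
  next
    case 2
    have "m \<le> card (W \<inter> v p ` {1..<1 + 2 * m})"
      using card_vertex_cover_segment[OF W p(1), of 1 m] m by simp
    then show ?thesis
    proof (rule sub)
      show "W \<inter> v p ` {1..<1 + 2 * m} \<subseteq> W \<inter> v p ` {0<..<l p}"
      proof
        fix x assume "x \<in> W \<inter> v p ` {1..<1 + 2 * m}"
        then obtain i where "x = v p i" "0 < i" "i \<le> l p" "x \<in> W" using m by auto
        moreover from this have "i \<noteq> l p" using 2 v_l[OF p(1)] by metis
        ultimately show "x \<in> W \<inter> v p ` {0<..<l p}" by auto
      qed
    qed
  next
    case 3
    let ?X = "W \<inter> v p ` {2..<2 + 2 * (m - 1)}"
    have "m - 1 \<le> card ?X"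
      using card_vertex_cover_segment[OF W p(1), of 2 "m - 1"] m by simp
    moreover have "v p 1 \<notin> ?X"
    proof
      assume "v p 1 \<in> ?X"
      then obtain i where "v p 1 = v p i" "2 \<le> i" "i \<le> l p"
        using m by auto
      then show False
        using v_inj[OF p(1), of 1 i] m by simp
    qed
    ultimately have "m \<le> card (insert (v p 1) ?X)"
      using m by simp
    then show ?thesis
      by (rule sub) (use 3 m in auto)
  qed
  then show ?thesis
    using m by simp
qed

text \<open>A path of odd length has a perfect matching. With both endpoints missing, all its hits
  are interior, one more than the interior matching gives.\<close>

lemma card_odd_interior_gt:
  assumes W: "vertex_cover G W" and "s \<notin> W" "t \<notin> W"
  shows "(l po - 1) div 2 < card (W \<inter> v po ` {0<..<l po})"
proof -
  obtain m where m: "l po = 2 * m + 1"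
    using po by (auto elim!: oddE)
  have "Suc m \<le> card (W \<inter> v po ` {0..<0 + 2 * Suc m})"
    using card_vertex_cover_segment[OF W po(1), of 0 "Suc m"] m by simp
  also have "\<dots> \<le> card (W \<inter> v po ` {0<..<l po})"
  proof (rule card_mono)
    show "W \<inter> v po ` {0..<0 + 2 * Suc m} \<subseteq> W \<inter> v po ` {0<..<l po}"
    proof
      fix x assume "x \<in> W \<inter> v po ` {0..<0 + 2 * Suc m}"
      then obtain i where "x = v po i" "i \<le> l po" "x \<in> W" using m by auto
      moreover from this have "i \<noteq> 0" "i \<noteq> l po"
        using assms v_0[OF po(1)] v_l[OF po(1)] by metis+
      ultimately show "x \<in> W \<inter> v po ` {0<..<l po}" by auto
    qed
  qed simp
  finally show ?thesis
    using m by simp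
qed

lemma card_vertex_cover_gt_min:
  assumes W: "vertex_cover G W"
    and "s \<notin> W \<or> t \<notin> W \<or> (\<exists>p \<in> P - {po}. v p 1 \<in> W)"
  shows "min_cover_size < card W"
proof -
  let ?h = "\<lambda>p. (l p - 1) div 2" and ?k = "\<lambda>p. card (W \<inter> v p ` {0<..<l p})"
  have sub: "W \<subseteq> pverts G" using W by (simp add: vertex_cover_def)
  have ge: "?h p \<le> ?k p" if "p \<in> P" for p
    using card_interior_ge[OF W that] .
  show ?thesis
  proof (cases "s \<in> W \<and> t \<in> W")
    case True
    then obtain p where p: "p \<in> P - {po}" "v p 1 \<in> W" using assms(2) by blast
    have "?h p < ?k p"
      using card_interior_gt[OF W, of p] p by auto
    then have "sum ?h P < sum ?k P"
      using p ge finite_P by (intro sum_strict_mono_ex1) auto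
    moreover have "W \<inter> {s, t} = {s, t}" using True by auto
    ultimately show ?thesis
      using card_decompose[OF sub] s_neq_t by (simp add: min_cover_size_def)
  next
    case False
    let ?d = "card (W \<inter> {s, t})"
    \<comment> \<open>One vertex is gained on \<open>po\<close> and its endpoints together: either
      \<open>s\<close> or \<open>t\<close> is in \<open>W\<close>, or both are missing and the
      interior of \<open>po\<close> pays.\<close>
    have po_le: "?h po + 1 \<le> ?d + ?k po"
    proof (cases "s \<in> W \<or> t \<in> W")
      case True
      then have "W \<inter> {s, t} \<noteq> {}" by auto
      then have "1 \<le> ?d"
        by (simp add: Suc_le_eq card_gt_0_iff)
      then show ?thesis using ge[OF po(1)] by linarith
    next
      case False
      then show ?thesis using card_odd_interior_gt[OF W] by simp
    qed
    have "?h p + 1 \<le> ?k p" if "p \<in> P - {po}" for p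
      using card_interior_gt[OF W, of p] that False by auto
    then have "(\<Sum>p \<in> P - {po}. ?h p + 1) \<le> sum ?k (P - {po})"
      by (rule sum_mono)
    then have "sum ?h (P - {po}) + card (P - {po}) \<le> sum ?k (P - {po})"
      by (simp only: sum.distrib) simp
    \<comment> \<open>Here \<open>card_P\<close> enters: two even paths pay one each, which together
      with \<open>po_le\<close> exceeds the 2 that \<open>min_cover_size\<close> reserves for
      \<open>s\<close> and \<open>t\<close>.\<close>
    moreover have "2 \<le> card (P - {po})"
      using card_P po(1) finite_P by simp
    ultimately show ?thesis
      using card_decompose[OF sub] po_le
        sum.remove[OF finite_P po(1), of ?h] sum.remove[OF finite_P po(1), of ?k]
      by (simp add: min_cover_size_def)
  qed
qed

lemma card_vertex_cover_ge_min:
  assumes W: "vertex_cover G W"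
  shows "min_cover_size \<le> card W"
proof (cases "s \<in> W \<and> t \<in> W")
  case True
  then have "W \<inter> {s, t} = {s, t}" by auto
  moreover have "(\<Sum>p \<in> P. (l p - 1) div 2) \<le> (\<Sum>p \<in> P. card (W \<inter> v p ` {0<..<l p}))"
    by (intro sum_mono card_interior_ge W)
  ultimately show ?thesis
    using card_decompose[of W] W s_neq_t by (simp add: vertex_cover_def min_cover_size_def)
next
  case False
  then show ?thesis
    using card_vertex_cover_gt_min[OF W] by auto
qed

lemma vc_eq: "vc G = min_cover_size"
  unfolding vc_def
proof (rule Least_equality)
  show "\<exists>U. vertex_cover G U \<and> card U = min_cover_size"
    using vertex_cover_parity_cover card_parity_cover[of "\<lambda>_. True"]
    by (intro exI[of _ "parity_cover (\<lambda>_. True)"]) simp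
qed (use card_vertex_cover_ge_min in auto)

text \<open>Supplies the second even path that takes over the external role from
  \<open>e\<close>.\<close>

lemma even_path_exists: "\<exists>p \<in> P. p \<noteq> po \<and> p \<noteq> e"
proof (rule ccontr)
  assume "\<not> ?thesis"
  then have "card P \<le> card {po, e}" by (intro card_mono) auto
  also have "\<dots> \<le> 2" by (simp add: card_insert_if)
  finally show False using card_P by simp
qed

lemma eternal_vc_class_size_gt:
  assumes "eternal_vc_class G n \<U>"
  shows "vc G < n"
proof -
  obtain U where U: "U \<in> \<U>" using assms by (auto simp: eternal_vc_class_def)
  have cover: "vertex_cover G U" "card U = n" if "U \<in> \<U>" for U
    using assms that by (auto simp: eternal_vc_class_def)
  obtain p where p: "p \<in> P" "p \<noteq> po" using even_path_exists by blast
  then have "(v p 0, v p (Suc 0)) \<in> parcs G"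
    using l_pos unfolding parcs_G by blast
  then have "(s, v p 1) \<in> parcs G"
    using v_0 p by simp
  then obtain \<phi> where \<phi>: "is_defense G U (s, v p 1) \<phi>" "\<phi> ` U \<in> \<U>"
    using assms U unfolding eternal_vc_class_def by blast
  \<comment> \<open>Either the guard of \<open>s\<close> moves to \<open>v p 1\<close> or a guard
    leaves \<open>v p 1\<close>. So \<open>v p 1\<close> is occupied before or after the move, and
    that cover is not minimum.\<close>
  have "s \<in> U \<and> \<phi> s = v p 1 \<or> v p 1 \<in> U"
    using \<phi>(1) by (auto simp: is_defense_def)
  then have hit: "v p 1 \<in> U \<or> v p 1 \<in> \<phi> ` U"
    by (metis imageI)
  have "vc G < n" if "W \<in> \<U>" "v p 1 \<in> W" for W
    using card_vertex_cover_gt_min[OF cover(1)[OF that(1)]] cover(2)[OF that(1)] that(2) p vc_eq by auto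
  then show ?thesis
    using hit U \<phi>(2) by blast
qed

subsection \<open>Moving the guards\<close>

text \<open>The map \<open>loc\<close> recovers the coordinates of an interior vertex, so moves
  given by path and index define a map on vertices.\<close>

lemma ex_vertex_map:
  fixes g :: "'i \<Rightarrow> nat \<Rightarrow> 'a"
  shows "\<exists>\<phi>. \<phi> s = a \<and> \<phi> t = b \<and> (\<forall>p \<in> P. \<forall>i. 0 < i \<longrightarrow> i < l p \<longrightarrow> \<phi> (v p i) = g p i)"
proof -
  define loc where "loc u = (THE z. fst z \<in> P \<and> 0 < snd z \<and> snd z < l (fst z) \<and> u = v (fst z) (snd z))" for u
  have loc: "loc (v p i) = (p, i)" if "p \<in> P" "0 < i" "i < l p" for p i
    unfolding loc_def
    by (rule the_equality)
      (use that interior_unique[OF that] in \<open>force, metis less_imp_le prod.collapse\<close>)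
  show ?thesis
    by (rule exI[of _ "\<lambda>u. if u = s then a else if u = t then b else g (fst (loc u)) (snd (loc u))"])
      (use s_neq_t interior_neq loc in auto)
qed

lemma closed_nbhd_path:
  assumes "p \<in> P" "i \<le> l p" "j \<le> l p" "j = i \<or> j = Suc i \<or> i = Suc j"
  shows "v p j \<in> closed_nbhd G (v p i)"
  using assms(4)
proof (elim disjE)
  assume "j = Suc i"
  then have "(v p i, v p j) \<in> parcs G"
    using assms unfolding parcs_G by (auto simp: Suc_le_eq)
  then show ?thesis by (simp add: closed_nbhd_def)
next
  assume "i = Suc j"
  then have "(v p i, v p j) \<in> parcs G"
    using assms unfolding parcs_G by (auto simp: Suc_le_eq)
  then show ?thesis by (simp add: closed_nbhd_def)
qed (simp add: closed_nbhd_def)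

text \<open>As source and target have equal size, injectivity follows from surjectivity.\<close>

lemma guard_move:
  assumes card: "card (parity_cover c) = card (parity_cover c')"
    and a: "a \<in> closed_nbhd G s" and b: "b \<in> closed_nbhd G t"
    and g: "\<And>p i. p \<in> P \<Longrightarrow> 0 < i \<Longrightarrow> i < l p \<Longrightarrow> (even i \<longleftrightarrow> c p) \<Longrightarrow> g p i \<in> closed_nbhd G (v p i)"
    and onto: "parity_cover c' \<subseteq>
      {a, b} \<union> {g p i | p i. p \<in> P \<and> 0 < i \<and> i < l p \<and> (even i \<longleftrightarrow> c p)}"
  obtains \<phi> where "\<phi> s = a" "\<phi> t = b"
    "\<And>p i. p \<in> P \<Longrightarrow> 0 < i \<Longrightarrow> i < l p \<Longrightarrow> \<phi> (v p i) = g p i"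
    "\<phi> ` parity_cover c = parity_cover c'" "inj_on \<phi> (parity_cover c)"
    "\<forall>u \<in> parity_cover c. \<phi> u \<in> closed_nbhd G u"
proof -
  obtain \<phi> where \<phi>: "\<phi> s = a" "\<phi> t = b"
    "\<And>p i. p \<in> P \<Longrightarrow> 0 < i \<Longrightarrow> i < l p \<Longrightarrow> \<phi> (v p i) = g p i"
    using ex_vertex_map[of a b g] by blast
  have fin: "finite (parity_cover d)" for d
    using parity_cover_subset finite_pverts by (rule finite_subset)
  have sub: "parity_cover c' \<subseteq> \<phi> ` parity_cover c"
  proof
    fix w assume "w \<in> parity_cover c'"
    then consider "w = a" | "w = b" |
      p i where "w = g p i" "p \<in> P" "0 < i" "i < l p" "even i \<longleftrightarrow> c p"
      using onto by blast
    then show "w \<in> \<phi> ` parity_cover c"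
    proof cases
      case 1 then show ?thesis using \<phi>(1) by (auto simp: parity_cover_def)
    next
      case 2 then show ?thesis using \<phi>(2) by (auto simp: parity_cover_def)
    next
      case 3
      then have "v p i \<in> parity_cover c" by (auto simp: parity_cover_def)
      then show ?thesis using 3 \<phi>(3) by (metis imageI)
    qed
  qed
  have im: "\<phi> ` parity_cover c = parity_cover c'"
    using card_seteq[OF _ sub] card_image_le[OF fin, of \<phi> c] fin card by simp
  then have "inj_on \<phi> (parity_cover c)"
    using card fin by (simp add: eq_card_imp_inj_on)
  moreover have "\<forall>u \<in> parity_cover c. \<phi> u \<in> closed_nbhd G u"
    using \<phi> a b g by (auto simp: parity_cover_def)
  ultimately show ?thesis
    using that \<phi> im by blast
qed

section \<open>Defenses between covers of the class\<close>

definition defended :: "('i \<Rightarrow> bool) \<Rightarrow> 'a \<times> 'a \<Rightarrow> ('i \<Rightarrow> bool) \<Rightarrow> bool" where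
  "defended c e c' \<longleftrightarrow> (\<exists>\<phi>. is_defense G (parity_cover c) e \<phi> \<and> \<phi> ` parity_cover c = parity_cover c')"

lemma defendedI:
  assumes "\<phi> ` parity_cover c = parity_cover c'" "inj_on \<phi> (parity_cover c)"
    "\<forall>u \<in> parity_cover c. \<phi> u \<in> closed_nbhd G u"
    "x \<in> parity_cover c \<and> \<phi> x = y \<or> y \<in> parity_cover c \<and> \<phi> y = x"
  shows "defended c (x, y) c'"
proof -
  have "\<phi> \<in> parity_cover c \<rightarrow> pverts G"
    using assms(1) parity_cover_subset[of c'] by auto
  then show ?thesis
    unfolding defended_def is_defense_def using assms by auto
qed

lemma defended_swap: "defended c (x, y) c' \<longleftrightarrow> defended c (y, x) c'"
  by (auto simp: defended_def is_defense_def)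

text \<open>\<open>class_parity e b\<close> describes \<open>U\<^sup>s\<^sub>e\<close> if \<open>b\<close> holds, and \<open>U\<^sup>t\<^sub>e\<close> otherwise.\<close>

definition class_parity :: "'i \<Rightarrow> bool \<Rightarrow> 'i \<Rightarrow> bool" where
  "class_parity e b p = (if p = po then b else p \<noteq> e)"

lemma card_class_cover:
  assumes "e \<in> P" "e \<noteq> po"
  shows "card (parity_cover (class_parity e b)) = min_cover_size + 1"
proof -
  have "{p \<in> P. p \<noteq> po \<and> \<not> class_parity e b p} = {e}"
    using assms by (auto simp: class_parity_def)
  then show ?thesis by (simp add: card_parity_cover)
qed

text \<open>Guards on \<open>e\<close> step down, the lowest one reaching \<open>s\<close>; the
  guard of \<open>s\<close> enters \<open>p\<close> and the guards on \<open>p\<close> step up;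
  \<open>t\<close> keeps its guard. Exactly the edges with even index \<open>j\<close> on
  \<open>e\<close> and \<open>p\<close> are traversed.\<close>

lemma defended_even_path:
  assumes e: "e \<in> P" "e \<noteq> po" and p: "p \<in> P" "p \<noteq> po" "p \<noteq> e"
    and q: "q = e \<or> q = p" and j: "even j" "j < l q"
  shows "defended (class_parity e b) (v q j, v q (Suc j)) (class_parity p b)"
proof -
  let ?c = "class_parity e b" and ?c' = "class_parity p b"
  let ?g = "\<lambda>q i. if q = e then v e (i - 1) else if q = p then v p (Suc i) else v q i"
  note ev = even_l[OF e] even_l[OF p(1,2)]
  obtain \<phi> where \<phi>: "\<phi> s = v p 1"
    "\<And>p i. p \<in> P \<Longrightarrow> 0 < i \<Longrightarrow> i < l p \<Longrightarrow> \<phi> (v p i) = ?g p i"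
    "\<phi> ` parity_cover ?c = parity_cover ?c'" "inj_on \<phi> (parity_cover ?c)"
    "\<forall>u \<in> parity_cover ?c. \<phi> u \<in> closed_nbhd G u"
  proof (rule guard_move[of ?c ?c' "v p 1" t ?g])
    show "card (parity_cover ?c) = card (parity_cover ?c')"
      using card_class_cover e p by simp
    show "v p 1 \<in> closed_nbhd G s"
      using closed_nbhd_path[OF p(1), of 0 1] v_0[OF p(1)] l_pos[OF p(1)] by simp
    show "t \<in> closed_nbhd G t" by (simp add: closed_nbhd_def)
    show "?g q i \<in> closed_nbhd G (v q i)" if "q \<in> P" "0 < i" "i < l q" for q i
      using that by (auto intro!: closed_nbhd_path)
    show "parity_cover ?c' \<subseteq>
      {v p 1, t} \<union> {?g q i | q i. q \<in> P \<and> 0 < i \<and> i < l q \<and> (even i \<longleftrightarrow> ?c q)}" (is "_ \<subseteq> _ \<union> ?R")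
    proof
      have R: "?g q i \<in> ?R" if "q \<in> P" "0 < i" "i < l q" "even i \<longleftrightarrow> ?c q" for q i
        using that by blast
      fix w assume "w \<in> parity_cover ?c'"
      then consider "w = s" | "w = t" |
        q i where "w = v q i" "q \<in> P" "0 < i" "i < l q" "even i \<longleftrightarrow> ?c' q"
        by (auto simp: parity_cover_def)
      then show "w \<in> {v p 1, t} \<union> ?R"
      proof cases
        case 1
        then show ?thesis
          using R[of e 1] e even_l_ge_2[OF e] v_0[OF e(1)] by (simp add: class_parity_def)
      next
        case 3
        \<comment> \<open>For each new position its guard is named: the upper neighbour on
          \<open>e\<close>, \<open>s\<close> for index 1 on \<open>p\<close>, the lower neighbour
          elsewhere on \<open>p\<close>, and the vertex itself on other paths.\<close>
        consider "q = e" | "q = p" "i = 1" | "q = p" "i \<noteq> 1" | "q \<noteq> e" "q \<noteq> p" by blast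
        then show ?thesis
        proof cases
          case 1
          then have "even i" using 3 e p by (simp add: class_parity_def)
          then have "Suc i < l e" using 3(4) 1 ev by (simp add: Suc_less_same_parity)
          then show ?thesis
            using R[of e "Suc i"] 1 3 e \<open>even i\<close> by (simp add: class_parity_def)
        next
          case 2
          then show ?thesis using 3 by simp
        next
          case q3: 3
          then have "odd i" using 3 p by (simp add: class_parity_def)
          then show ?thesis
            using R[of p "i - 1"] q3 3 p by (simp add: class_parity_def)
        next
          case 4
          then show ?thesis
            using R[of q i] 3 by (auto simp: class_parity_def)
        qed
      qed simp
    qed
  qed (use that in blast)
  show ?thesis
  proof (rule defendedI[OF \<phi>(3-5)])
    consider "q = e" | "q = p" "j = 0" | "q = p" "0 < j" using q by blast
    then show "v q j \<in> parity_cover ?c \<and> \<phi> (v q j) = v q (Suc j) \<or>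
      v q (Suc j) \<in> parity_cover ?c \<and> \<phi> (v q (Suc j)) = v q j"
    proof cases
      case 1
      then have "Suc j < l e" using j ev by (simp add: Suc_less_same_parity)
      then show ?thesis
        using 1 e j \<phi>(2)[of e "Suc j"] by (simp add: v_in_parity_cover class_parity_def)
    next
      case 2
      then show ?thesis using \<phi>(1) v_0[OF p(1)] by (simp add: parity_cover_def)
    next
      case 3
      then show ?thesis
        using p j \<phi>(2)[of p j] by (simp add: v_in_parity_cover class_parity_def)
    qed
  qed
qed

text \<open>The guards move along the walk that descends \<open>e\<close> to \<open>s\<close>,
  ascends \<open>po\<close> to \<open>t\<close> and descends into \<open>p\<close>. This traverses
  every edge of even index on \<open>po\<close> and passes the external role from \<open>e\<close>
  to \<open>p\<close>.\<close>

lemma defended_odd_path_rotate: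
  assumes e: "e \<in> P" "e \<noteq> po" and p: "p \<in> P" "p \<noteq> po" "p \<noteq> e"
    and j: "even j" "j < l po"
  shows "defended (class_parity e True) (v po j, v po (Suc j)) (class_parity p False)"
proof -
  let ?c = "class_parity e True" and ?c' = "class_parity p False"
  let ?g = "\<lambda>q i. if q = po then v po (Suc i) else if q = e \<or> q = p then v q (i - 1) else v q i"
  note ev = even_l[OF e] even_l[OF p(1,2)]
  obtain \<phi> where \<phi>: "\<phi> s = v po 1"
    "\<And>p i. p \<in> P \<Longrightarrow> 0 < i \<Longrightarrow> i < l p \<Longrightarrow> \<phi> (v p i) = ?g p i"
    "\<phi> ` parity_cover ?c = parity_cover ?c'" "inj_on \<phi> (parity_cover ?c)"
    "\<forall>u \<in> parity_cover ?c. \<phi> u \<in> closed_nbhd G u"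
  proof (rule guard_move[of ?c ?c' "v po 1" "v p (l p - 1)" ?g])
    show "card (parity_cover ?c) = card (parity_cover ?c')"
      using card_class_cover e p by simp
    show "v po 1 \<in> closed_nbhd G s"
      using closed_nbhd_path[OF po(1), of 0 1] v_0[OF po(1)] l_pos[OF po(1)] by simp
    show "v p (l p - 1) \<in> closed_nbhd G t"
      using closed_nbhd_path[OF p(1), of "l p" "l p - 1"] v_l[OF p(1)] l_pos[OF p(1)] by simp
    show "?g q i \<in> closed_nbhd G (v q i)" if "q \<in> P" "0 < i" "i < l q" for q i
      using that by (auto intro!: closed_nbhd_path)
    show "parity_cover ?c' \<subseteq> {v po 1, v p (l p - 1)} \<union>
      {?g q i | q i. q \<in> P \<and> 0 < i \<and> i < l q \<and> (even i \<longleftrightarrow> ?c q)}" (is "_ \<subseteq> _ \<union> ?R")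
    proof
      have R: "?g q i \<in> ?R" if "q \<in> P" "0 < i" "i < l q" "even i \<longleftrightarrow> ?c q" for q i
        using that by blast
      fix w assume "w \<in> parity_cover ?c'"
      then consider "w = s" | "w = t" |
        q i where "w = v q i" "q \<in> P" "0 < i" "i < l q" "even i \<longleftrightarrow> ?c' q"
        by (auto simp: parity_cover_def)
      then show "w \<in> {v po 1, v p (l p - 1)} \<union> ?R"
      proof cases
        case 1
        then show ?thesis
          using R[of e 1] e even_l_ge_2[OF e] v_0[OF e(1)] by (simp add: class_parity_def)
      next
        case 2
        show ?thesis
        \<comment> \<open>If \<open>po\<close> is a single edge, \<open>t\<close> is filled directly
          from \<open>s\<close>; otherwise it is filled from the last interior vertex of
          \<open>po\<close>.\<close>
        proof (cases "l po = 1")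
          case True
          then show ?thesis using 2 v_l[OF po(1)] by simp
        next
          case False
          then have "1 < l po" using l_pos[OF po(1)] by linarith
          then show ?thesis
            using R[of po "l po - 1"] 2 po v_l[OF po(1)] by (simp add: class_parity_def)
        qed
      next
        case 3
        \<comment> \<open>Index \<open>l p - 1\<close> on \<open>p\<close> is filled from
          \<open>t\<close> and index 1 on \<open>po\<close> from \<open>s\<close>. Other positions
          on \<open>e\<close>, \<open>p\<close> and \<open>po\<close> are filled from an interior
          neighbour.\<close>
        consider "q = e" | "q = p" "i = l p - 1" | "q = p" "i \<noteq> l p - 1" | "q = po" "i = 1" |
          "q = po" "i \<noteq> 1" | "q \<noteq> e" "q \<noteq> p" "q \<noteq> po" by blast
        then show ?thesis
        proof cases
          case 1
          then have "even i" using 3 e p by (simp add: class_parity_def)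
          then have "Suc i < l e" using 3(4) 1 ev by (simp add: Suc_less_same_parity)
          then show ?thesis
            using R[of e "Suc i"] 1 3 e \<open>even i\<close> by (simp add: class_parity_def)
        next
          case 2
          then show ?thesis using 3 by simp
        next
          case q3: 3
          then have "odd i" using 3 p by (simp add: class_parity_def)
          moreover have "Suc i < l p" using 3(4) q3 by auto
          ultimately show ?thesis
            using R[of p "Suc i"] q3 3 p by (simp add: class_parity_def)
        next
          case 4
          then show ?thesis using 3 by simp
        next
          case 5
          then have "odd i" using 3 by (simp add: class_parity_def)
          then show ?thesis
            using R[of po "i - 1"] 5 3 by (simp add: class_parity_def)
        next
          case 6
          then show ?thesis
            using R[of q i] 3 by (auto simp: class_parity_def)
        qed
      qed
    qed
  qed (use that in blast)
  show ?thesis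
  proof (rule defendedI[OF \<phi>(3-5)])
    show "v po j \<in> parity_cover ?c \<and> \<phi> (v po j) = v po (Suc j) \<or>
      v po (Suc j) \<in> parity_cover ?c \<and> \<phi> (v po (Suc j)) = v po j"
    proof (cases "j = 0")
      case True
      then show ?thesis using \<phi>(1) v_0[OF po(1)] by (simp add: parity_cover_def)
    next
      case False
      then show ?thesis
        using po j \<phi>(2)[of po j] by (simp add: v_in_parity_cover class_parity_def)
    qed
  qed
qed

text \<open>Interior guards of \<open>po\<close> sit at even indices and step down to odd ones,
  using the edges of odd index. All other guards stay, so \<open>e\<close> remains external.\<close>

lemma defended_odd_path_shift:
  assumes e: "e \<in> P" "e \<noteq> po" and j: "odd j" "j < l po"
  shows "defended (class_parity e True) (v po j, v po (Suc j)) (class_parity e False)"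
proof -
  let ?c = "class_parity e True" and ?c' = "class_parity e False"
  let ?g = "\<lambda>q i. if q = po then v po (i - 1) else v q i"
  obtain \<phi> where \<phi>:
    "\<And>p i. p \<in> P \<Longrightarrow> 0 < i \<Longrightarrow> i < l p \<Longrightarrow> \<phi> (v p i) = ?g p i"
    "\<phi> ` parity_cover ?c = parity_cover ?c'" "inj_on \<phi> (parity_cover ?c)"
    "\<forall>u \<in> parity_cover ?c. \<phi> u \<in> closed_nbhd G u"
  proof (rule guard_move[of ?c ?c' s t ?g])
    show "card (parity_cover ?c) = card (parity_cover ?c')"
      using card_class_cover e by simp
    show "s \<in> closed_nbhd G s" "t \<in> closed_nbhd G t" by (simp_all add: closed_nbhd_def)
    show "?g q i \<in> closed_nbhd G (v q i)" if "q \<in> P" "0 < i" "i < l q" for q i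
      using that by (auto intro!: closed_nbhd_path)
    show "parity_cover ?c' \<subseteq> {s, t} \<union>
      {?g q i | q i. q \<in> P \<and> 0 < i \<and> i < l q \<and> (even i \<longleftrightarrow> ?c q)}" (is "_ \<subseteq> _ \<union> ?R")
    proof
      have R: "?g q i \<in> ?R" if "q \<in> P" "0 < i" "i < l q" "even i \<longleftrightarrow> ?c q" for q i
        using that by blast
      fix w assume "w \<in> parity_cover ?c'"
      then consider "w \<in> {s, t}" |
        q i where "w = v q i" "q \<in> P" "0 < i" "i < l q" "even i \<longleftrightarrow> ?c' q"
        by (auto simp: parity_cover_def)
      then show "w \<in> {s, t} \<union> ?R"
      proof cases
        case 2
        show ?thesis
        proof (cases "q = po")
          case True
          then have "odd i" using 2 by (simp add: class_parity_def)
          then have "Suc i < l po" using 2(4) True po(2) by (simp add: Suc_less_same_parity)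
          then show ?thesis
            using R[of po "Suc i"] 2 True \<open>odd i\<close> by (simp add: class_parity_def)
        next
          case False
          then show ?thesis
            using R[of q i] 2 by (auto simp: class_parity_def)
        qed
      qed blast
    qed
  qed (use that in blast)
  have "Suc j < l po" using j po(2) by (simp add: Suc_less_same_parity)
  then show ?thesis
    using po j \<phi>(1)[of po "Suc j"]
    by (intro defendedI[OF \<phi>(2-4)]) (simp add: v_in_parity_cover class_parity_def)
qed

section \<open>Exchange of \<open>s\<close> and \<open>t\<close>, and answers to all attacks\<close>

interpretation reverse: one_odd_melon G P po "\<lambda>p i. v p (l p - i)" l t s
  by (rule one_odd_melon_reverse)

text \<open>Replacing \<open>i\<close> by \<open>l p - i\<close> preserves parity on even paths and
  flips it on \<open>po\<close>, so only the flag \<open>b\<close> is negated.\<close>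

lemma reverse_class_cover:
  assumes "e \<in> P" "e \<noteq> po"
  shows "reverse.parity_cover (reverse.class_parity e b) = parity_cover (class_parity e (\<not> b))"
proof -
  have par: "(even (l p - i) \<longleftrightarrow> class_parity e (\<not> b) p) \<longleftrightarrow> (even i \<longleftrightarrow> class_parity e b p)"
    if "p \<in> P" "i < l p" for p i
    using that po even_l[OF that(1)] by (auto simp: class_parity_def)
  have "{v p (l p - i) |p i. p \<in> P \<and> 0 < i \<and> i < l p \<and> (even i \<longleftrightarrow> class_parity e b p)} =
      {v p i |p i. p \<in> P \<and> 0 < i \<and> i < l p \<and> (even i \<longleftrightarrow> class_parity e (\<not> b) p)}" (is "?L = ?R")
  proof (intro equalityI subsetI)
    fix x assume "x \<in> ?L"
    then obtain p i where "x = v p (l p - i)" "p \<in> P" "0 < i" "i < l p" "even i \<longleftrightarrow> class_parity e b p"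
      by blast
    then show "x \<in> ?R"
      using par[of p i] by (intro CollectI exI[of _ p] exI[of _ "l p - i"]) auto
  next
    fix x assume "x \<in> ?R"
    then obtain p i where "x = v p i" "p \<in> P" "0 < i" "i < l p" "even i \<longleftrightarrow> class_parity e (\<not> b) p"
      by blast
    then show "x \<in> ?L"
      using par[of p "l p - i"] by (intro CollectI exI[of _ p] exI[of _ "l p - i"]) auto
  qed
  then show ?thesis
    unfolding reverse.parity_cover_def parity_cover_def reverse.class_parity_def
    by (auto simp: class_parity_def insert_commute)
qed

lemma reverse_defended:
  assumes "reverse.defended (reverse.class_parity e b) (v q (l q - i), v q (l q - Suc i)) (reverse.class_parity p b')"
    and "e \<in> P" "e \<noteq> po" "p \<in> P" "p \<noteq> po"
  shows "defended (class_parity e (\<not> b)) (v q (l q - Suc i), v q (l q - i)) (class_parity p (\<not> b'))"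
  using assms unfolding defended_swap[of _ "v q (l q - Suc i)"]
  unfolding reverse.defended_def defended_def by (simp add: reverse_class_cover)

text \<open>The preceding moves treat half of the cases: even \<open>j\<close> on even paths, and
  \<open>b = True\<close> on \<open>po\<close>. The other half follows from the reversed instance,
  in which the attacked edge has index \<open>i\<close>.\<close>

lemma class_defended:
  assumes e: "e \<in> P" "e \<noteq> po" and q: "q \<in> P" and j: "j < l q"
  shows "\<exists>p b'. p \<in> P \<and> p \<noteq> po \<and> defended (class_parity e b) (v q j, v q (Suc j)) (class_parity p b')"
proof -
  obtain p0 where p0: "p0 \<in> P" "p0 \<noteq> po" "p0 \<noteq> e" using even_path_exists by blast
  define i where "i = l q - Suc j"
  have i: "l q - i = Suc j" "l q - Suc i = j" "i < l q" using j by (auto simp: i_def)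
  show ?thesis
  proof (cases "q = po")
    case False
    \<comment> \<open>The new external path is the attacked one, unless that is already external;
      then any other even path serves.\<close>
    define p where "p = (if q = e then p0 else q)"
    have p: "p \<in> P" "p \<noteq> po" "p \<noteq> e" "q = e \<or> q = p"
      using p0 q False by (auto simp: p_def)
    have "defended (class_parity e b) (v q j, v q (Suc j)) (class_parity p b)"
    proof (cases "even j")
      case True
      then show ?thesis using defended_even_path[OF e p] j by simp
    next
      case odd: False
      then have "even i" using even_l[OF q False] j by (simp add: i_def)
      then show ?thesis
        using reverse_defended[OF reverse.defended_even_path[OF e p(1-3) p(4) _ i(3), of "\<not> b"] e p(1,2)] i
        by simp
    qed
    then show ?thesis using p by blast
  next
    case True
    \<comment> \<open>As \<open>l po\<close> is odd, reversal keeps the parity of edge indices on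
      \<open>po\<close>, so rotation and shift keep their roles.\<close>
    have "even i \<longleftrightarrow> even j" using po j True by (simp add: i_def)
    have "\<exists>p b'. p \<in> P \<and> p \<noteq> po \<and> defended (class_parity e True) (v q j, v q (Suc j)) (class_parity p b')"
      using defended_odd_path_rotate[OF e p0, of j] defended_odd_path_shift[OF e, of j] e p0 j True
      by (cases "even j") auto
    moreover have "defended (class_parity e False) (v q j, v q (Suc j)) (class_parity p0 True)" if "even i"
      using reverse_defended[of e True q i p0 False]
        reverse.defended_odd_path_rotate[OF e p0, of i] e p0 i True that by simp
    moreover have "defended (class_parity e False) (v q j, v q (Suc j)) (class_parity e True)" if "odd i"
      using reverse_defended[of e True q i e False]
        reverse.defended_odd_path_shift[OF e, of i] e i True that by simp
    ultimately show ?thesis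
      using e p0 by (cases b; cases "even i"; simp only: simp_thms; blast)
  qed
qed

section \<open>The class of covers and its minimality\<close>

definition cover_class :: "'a set set" where
  "cover_class = {parity_cover (class_parity e b) | e b. e \<in> P \<and> e \<noteq> po}"

lemma eternal_cover_class: "eternal_vc_class G (vc G + 1) cover_class"
  unfolding eternal_vc_class_def
proof (intro conjI ballI)
  show "cover_class \<noteq> {}"
    using even_path_exists unfolding cover_class_def by blast
  show "vertex_cover G U" "card U = vc G + 1" if "U \<in> cover_class" for U
    using that vertex_cover_parity_cover card_class_cover by (auto simp: cover_class_def vc_eq)
  fix U a assume U: "U \<in> cover_class" and a: "a \<in> parcs G"
  then obtain e b where e: "e \<in> P" "e \<noteq> po" "U = parity_cover (class_parity e b)"
    by (auto simp: cover_class_def)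
  obtain q j where q: "q \<in> P" "j < l q" "a = (v q j, v q (Suc j)) \<or> a = (v q (Suc j), v q j)"
    using a unfolding parcs_G by blast
  obtain p b' where "p \<in> P" "p \<noteq> po" "defended (class_parity e b) a (class_parity p b')"
    using class_defended[OF e(1,2) q(1,2), of b] q(3) defended_swap by blast
  then show "\<exists>\<phi>. is_defense G U a \<phi> \<and> \<phi> ` U \<in> cover_class"
    unfolding defended_def cover_class_def e(3) by blast
qed

lemma evc_eq: "evc G = vc G + 1"
  unfolding evc_def
  by (rule Least_equality)
    (use eternal_cover_class eternal_vc_class_size_gt in \<open>auto simp: Suc_le_eq\<close>)

lemma minimum_cover_class: "minimum_eternal_vc_class G cover_class"
  unfolding minimum_eternal_vc_class_def evc_eq by (rule eternal_cover_class)

end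

subsection \<open>Melon graphs as vertex lists\<close>

lemma nth_image_vwalk:
  assumes "1 \<le> vwalk_length p"
  shows "(!) p ` {..vwalk_length p} = set p"
proof -
  have "{..vwalk_length p} = {0..<length p}"
    using assms by (auto simp: vwalk_length_def)
  then show ?thesis
    using nth_image[of "length p" p] by simp
qed

text \<open>The vertex lists serve as their own indices, so that \<open>v p i\<close> becomes
  \<open>p ! i\<close>.\<close>

lemma melon_graph_one_odd_melon:
  assumes "k \<ge> 3" and melon: "melon_graph k G s t Ps" and odd: "odd_paths Ps = {Po}"
  shows "one_odd_melon G Ps Po (!) vwalk_length s t"
proof
  have path: "distinct p" "1 \<le> vwalk_length p" "hd p = s" "last p = t" if "p \<in> Ps" for p
    using melon that by (auto simp: melon_graph_def vpath_def)
  have len: "length p = Suc (vwalk_length p)" if "p \<in> Ps" for p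
    using path(2)[OF that] by (auto simp: vwalk_length_def)
  show "finite Ps" "3 \<le> card Ps"
    using melon assms(1) by (auto simp: melon_graph_def)
  show "Po \<in> Ps" "\<not> even (vwalk_length Po)"
    using odd by (auto simp: odd_paths_def)
  show "even (vwalk_length p)" if "p \<in> Ps" "p \<noteq> Po" for p
    using that odd by (auto simp: odd_paths_def)
  show "0 < vwalk_length p" if "p \<in> Ps" for p
    using path(2)[OF that] by simp
  show "p ! 0 = s" if "p \<in> Ps" for p
    using path(3)[OF that] len[OF that] by (metis hd_conv_nth length_0_conv nat.distinct(1))
  show "p ! vwalk_length p = t" if "p \<in> Ps" for p
    using path(4)[OF that] len[OF that] by (metis diff_Suc_1 last_conv_nth length_0_conv nat.distinct(1))
  show "i = j" if "p \<in> Ps" "i \<le> vwalk_length p" "j \<le> vwalk_length p" "p ! i = p ! j" for p i j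
    using that path(1)[OF that(1)] len[OF that(1)] nth_eq_iff_index_eq[of p i j] by linarith
  show "p ! i \<in> {s, t}" if "p \<in> Ps" "q \<in> Ps" "p \<noteq> q" "i \<le> vwalk_length p" "j \<le> vwalk_length q"
    "p ! i = q ! j" for p q i j
  proof -
    have "p ! i \<in> set p" "q ! j \<in> set q"
      using that(4,5) len[OF that(1)] len[OF that(2)] by (auto intro!: nth_mem simp del: vwalk_length_simp)
    then have "p ! i \<in> set p \<inter> set q"
      unfolding that(6) by blast
    then show ?thesis
      using melon that(1-3) unfolding melon_graph_def by (meson subsetD)
  qed
  show "pverts G = (\<Union>p \<in> Ps. (!) p ` {..vwalk_length p})"
    using melon nth_image_vwalk[OF path(2)] by (simp add: melon_graph_def del: vwalk_length_simp)
  have "parcs G = (\<Union>p \<in> Ps. set (vwalk_arcs p) \<union> (set (vwalk_arcs p))\<inverse>)"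
    using melon by (simp add: melon_graph_def)
  then show "parcs G = {(p ! i, p ! Suc i) | p i. p \<in> Ps \<and> i < vwalk_length p} \<union>
      {(p ! Suc i, p ! i) | p i. p \<in> Ps \<and> i < vwalk_length p}"
    unfolding set_vwalk_arcs by auto
qed

text \<open>The definite description is resolved by showing that the parity cover meets the
  conditions and that these determine the intersection with every path.\<close>

lemma melon_cover_eq:
  assumes k: "k \<ge> 3" and melon: "melon_graph k G s t Ps" and odd: "odd_paths Ps = {Po}"
    and x: "x \<in> {s, t}" and Pe: "Pe \<in> even_paths Ps"
  shows "melon_cover G s t Ps Po x Pe = one_odd_melon.parity_cover Ps (!) vwalk_length s t
    (one_odd_melon.class_parity Po Pe (x = s))"
proof -
  interpret one_odd_melon G Ps Po "(!)" vwalk_length s t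
    by (rule melon_graph_one_odd_melon[OF k melon odd])
  let ?U = "parity_cover (class_parity Pe (x = s))"
  have Pe': "Pe \<in> Ps" "Pe \<noteq> Po"
    using Pe po by (auto simp: even_paths_def)
  have even_eq: "even_paths Ps = Ps - {Po}"
    using odd by (auto simp: even_paths_def odd_paths_def)
  have len: "1 \<le> vwalk_length p" "length p = Suc (vwalk_length p)" if "p \<in> Ps" for p
    using l_pos[OF that] by (auto simp: vwalk_length_def)
  have set: "(!) p ` {..vwalk_length p} = set p" if "p \<in> Ps" for p
    using nth_image_vwalk len that by blast
  have U_Int: "?U \<inter> set p = (!) p ` {i. i \<le> vwalk_length p \<and>
      (i = 0 \<or> i = vwalk_length p \<or> (even i \<longleftrightarrow> class_parity Pe (x = s) p))}" if "p \<in> Ps" for p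
    using v_in_parity_cover[OF that] unfolding set[OF that, symmetric] by auto
  have ext: "external_path s t ?U Pe"
  proof -
    have "{i. i \<le> vwalk_length Pe \<and> (i = 0 \<or> i = vwalk_length Pe \<or> odd i)} =
        {2 * j + 1 | j. j < vwalk_length Pe div 2} \<union> {0, vwalk_length Pe}"
      using even_l[OF Pe'] by (auto elim!: oddE)
    then show ?thesis
      unfolding external_path_def U_Int[OF Pe'(1)]
      using Pe' v_0[OF Pe'(1)] v_l[OF Pe'(1)] by (auto simp: class_parity_def)
  qed
  have int: "internal_path ?U p" if "p \<in> even_paths Ps - {Pe}" for p
  proof -
    have p: "p \<in> Ps" "p \<noteq> Po" "p \<noteq> Pe" using that even_eq by auto
    have "{i. i \<le> vwalk_length p \<and> (i = 0 \<or> i = vwalk_length p \<or> even i)} =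
        {2 * j | j. j \<le> vwalk_length p div 2}"
      using even_l[OF p(1,2)] by (elim evenE) (auto simp del: vwalk_length_simp elim!: evenE)
    then show ?thesis
      unfolding internal_path_def U_Int[OF p(1)] using p by (auto simp: class_parity_def)
  qed
  obtain n where n: "vwalk_length Po = 2 * n + 1"
    using po(2) by (rule oddE)
  have rev_nth: "rev Po ! i = Po ! (2 * n + 1 - i)" if "i \<le> 2 * n + 1" for i
    using that len(2)[OF po(1)] n by (simp add: rev_nth)
  \<comment> \<open>As \<open>Po\<close> has odd length, an odd position counted from
    \<open>t\<close> is an even position counted from \<open>s\<close>; \<open>idx_t\<close> is the
    complementary case.\<close>
  have idx_s: "{rev Po ! (2 * i + 1) | i. i \<le> vwalk_length Po div 2} = (!) Po ` {i. i \<le> 2 * n + 1 \<and> even i}"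
  proof (intro equalityI subsetI)
    fix y assume "y \<in> {rev Po ! (2 * i + 1) | i. i \<le> vwalk_length Po div 2}"
    then obtain i where "y = rev Po ! (2 * i + 1)" "i \<le> n" using n by auto
    then show "y \<in> (!) Po ` {i. i \<le> 2 * n + 1 \<and> even i}"
      using rev_nth[of "2 * i + 1"] by (intro image_eqI[of _ _ "2 * n - 2 * i"]) auto
  next
    fix y assume "y \<in> (!) Po ` {i. i \<le> 2 * n + 1 \<and> even i}"
    then obtain j where "y = Po ! (2 * j)" "j \<le> n" by (auto elim!: evenE)
    moreover from this have "2 * n + 1 - (2 * (n - j) + 1) = 2 * j" by simp
    ultimately have "y = rev Po ! (2 * (n - j) + 1)" "n - j \<le> vwalk_length Po div 2"
      using rev_nth[of "2 * (n - j) + 1"] n by auto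
    then show "y \<in> {rev Po ! (2 * i + 1) | i. i \<le> vwalk_length Po div 2}" by blast
  qed
  have idx_t: "{rev Po ! (2 * i) | i. i \<le> vwalk_length Po div 2} = (!) Po ` {i. i \<le> 2 * n + 1 \<and> odd i}"
  proof (intro equalityI subsetI)
    fix y assume "y \<in> {rev Po ! (2 * i) | i. i \<le> vwalk_length Po div 2}"
    then obtain i where "y = rev Po ! (2 * i)" "i \<le> n" using n by auto
    then show "y \<in> (!) Po ` {i. i \<le> 2 * n + 1 \<and> odd i}"
      using rev_nth[of "2 * i"] by (intro image_eqI[of _ _ "2 * n + 1 - 2 * i"]) auto
  next
    fix y assume "y \<in> (!) Po ` {i. i \<le> 2 * n + 1 \<and> odd i}"
    then obtain j where "y = Po ! (2 * j + 1)" "j \<le> n" by (auto elim!: oddE)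
    moreover from this have "2 * n + 1 - 2 * (n - j) = 2 * j + 1" by simp
    ultimately have "y = rev Po ! (2 * (n - j))" "n - j \<le> vwalk_length Po div 2"
      using rev_nth[of "2 * (n - j)"] n by auto
    then show "y \<in> {rev Po ! (2 * i) | i. i \<le> vwalk_length Po div 2}" by blast
  qed
  have ends: "s = Po ! 0" "t = Po ! (2 * n + 1)"
    using v_0[OF po(1)] v_l[OF po(1)] unfolding n by simp_all
  have image_diff: "(!) Po ` A - {Po ! j} = (!) Po ` (A - {j})"
    if "A \<subseteq> {..2 * n + 1}" "j \<le> 2 * n + 1" for A j
    using inj_on_image_set_diff[OF path_inj_on[OF po(1) order_refl], of A "{j}"] that unfolding n
    by auto
  let ?X = "\<lambda>b. {i. i \<le> 2 * n + 1 \<and> (i = 0 \<or> i = 2 * n + 1 \<or> (even i \<longleftrightarrow> b))}"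
  have U_Po: "?U \<inter> set Po = (!) Po ` ?X (x = s)"
    unfolding U_Int[OF po(1)] n by (simp add: class_parity_def)
  have Po_path: "if x = s then s_path t ?U Po else t_path s ?U Po"
  proof (cases "x = s")
    case True
    have "?X True - {2 * n + 1} = {i. i \<le> 2 * n + 1 \<and> even i}"
      by auto
    then have "?U \<inter> set Po - {t} = (!) Po ` {i. i \<le> 2 * n + 1 \<and> even i}"
      using U_Po True image_diff[of "?X True" "2 * n + 1"] ends(2) by auto
    then show ?thesis using True unfolding s_path_def idx_s by simp
  next
    case False
    have "?X False - {0} = {i. i \<le> 2 * n + 1 \<and> odd i}"
      by (auto simp: odd_pos)
    then have "?U \<inter> set Po - {s} = (!) Po ` {i. i \<le> 2 * n + 1 \<and> odd i}"
      using U_Po False image_diff[of "?X False" 0] ends(1) by auto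
    then show ?thesis using False unfolding t_path_def idx_t by simp
  qed
  show ?thesis
    unfolding melon_cover_def
  proof (rule the_equality)
    show "?U \<subseteq> pverts G \<and> external_path s t ?U Pe \<and>
        (\<forall>p \<in> even_paths Ps - {Pe}. internal_path ?U p) \<and>
        (if x = s then s_path t ?U Po else t_path s ?U Po)"
      using parity_cover_subset ext int Po_path by blast
    fix W assume W: "W \<subseteq> pverts G \<and> external_path s t W Pe \<and>
        (\<forall>p \<in> even_paths Ps - {Pe}. internal_path W p) \<and>
        (if x = s then s_path t W Po else t_path s W Po)"
    have st: "s \<in> W" "t \<in> W"
      using W unfolding external_path_def by blast+
    have st': "s \<in> ?U" "t \<in> ?U"
      using ext unfolding external_path_def by blast+
    have "W \<inter> set p = ?U \<inter> set p" if p: "p \<in> Ps" for p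
    proof -
      consider "p = Pe" | "p \<in> even_paths Ps - {Pe}" | "p = Po"
        using p even_eq by blast
      then show ?thesis
      proof cases
        case 1
        then show ?thesis using W ext by (simp add: external_path_def)
      next
        case 2
        then show ?thesis using W int by (simp add: internal_path_def)
      next
        case 3
        \<comment> \<open>The condition on \<open>Po\<close> leaves one endpoint open, but both
          endpoints are in the set because \<open>Pe\<close> is external.\<close>
        have "W \<inter> set Po - {t} = ?U \<inter> set Po - {t} \<or> W \<inter> set Po - {s} = ?U \<inter> set Po - {s}"
          using W Po_path by (auto simp: s_path_def t_path_def split: if_splits)
        then show ?thesis using 3 st st' by blast
      qed
    qed
    moreover have "pverts G = (\<Union>p \<in> Ps. set p)"
      using melon by (simp add: melon_graph_def)
    ultimately show "W = ?U"
      using W parity_cover_subset by blast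
  qed
qed

theorem theorem14:
  fixes G :: "'a pair_pre_digraph" and s t :: 'a and k :: nat
    and Ps :: "'a vwalk set" and Po :: "'a vwalk"
  assumes "k \<ge> 3"
    and "melon_graph k G s t Ps"
    and "mixed Ps"
    and "odd_paths Ps = {Po}"
  shows "evc G = vc G + 1 \<and>
    minimum_eternal_vc_class G
      {melon_cover G s t Ps Po x Pe | x Pe. x \<in> {s, t} \<and> Pe \<in> even_paths Ps}"
proof -
  interpret one_odd_melon G Ps Po "(!)" vwalk_length s t
    by (rule melon_graph_one_odd_melon[OF assms(1,2,4)])
  have even_iff: "p \<in> even_paths Ps \<longleftrightarrow> p \<in> Ps \<and> p \<noteq> Po" for p
    using assms(4) by (auto simp: even_paths_def odd_paths_def)
  have "{melon_cover G s t Ps Po x Pe | x Pe. x \<in> {s, t} \<and> Pe \<in> even_paths Ps} = cover_class"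
  proof (intro equalityI subsetI)
    fix U assume "U \<in> {melon_cover G s t Ps Po x Pe | x Pe. x \<in> {s, t} \<and> Pe \<in> even_paths Ps}"
    then show "U \<in> cover_class"
      using melon_cover_eq[OF assms(1,2,4)] even_iff unfolding cover_class_def by blast
  next
    fix U assume "U \<in> cover_class"
    then obtain e b where e: "e \<in> even_paths Ps" "U = parity_cover (class_parity e b)"
      by (auto simp: cover_class_def even_iff)
    \<comment> \<open>Since \<open>s\<close> and \<open>t\<close> differ, \<open>?x = s\<close>
      holds exactly when \<open>b\<close> does.\<close>
    let ?x = "if b then s else t"
    have "U = melon_cover G s t Ps Po ?x e"
      using melon_cover_eq[OF assms(1,2,4) _ e(1), of ?x] e(2) s_neq_t by (cases b) auto
    then show "U \<in> {melon_cover G s t Ps Po x Pe | x Pe. x \<in> {s, t} \<and> Pe \<in> even_paths Ps}"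
      using e(1) by (intro CollectI exI[of _ ?x] exI[of _ e]) auto
  qed
  then show ?thesis
    using evc_eq minimum_cover_class by simp
qed

end
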